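(* Let $G$ be a stackable group over a finite symmetric generating set $A$, with stackable structure $(\mathcal N,<,k)$, and let $\phi$ be a stacking map for this structure, with stacking relation set $R_\phi$. Then $G$ is finitely presented by $\langle A\mid R_\phi\rangle$. Moreover, the set $\mathcal N$ of normal forms of the stackable structure is closed under taking prefixes.
   Context: Conventions. A finite generating set $A$ of a group $G$ is symmetric if it is closed under inversion; for $a\in A$, $a^{-1}\in A$ denotes the inverse letter, and in the group presentation $\langle A\mid R_\phi\rangle$ the letter $a^{-1}$ is understood as the inverse of the generator $a$. Standing assumption: no element of $A$ represents the identity of $G$. $A^*$ is the set of words over $A$; $v=_Gw$ means that the words $v,w$ represent the same element of $G$. Let $\Gamma=\Gamma(G,A)$ be the Cayley graph and $\vec E$ its set of directed edges. For $g\in G$, $a\in A$, let $e_{g,a}\in\vec E$ be the directed edge with initial vertex $g$, terminal vertex $ga$ and label $a$. Normal forms. A set of normal forms for $G$ over $A$ is a subset $\mathcal N\subset A^*$ such that the canonical map $A^*\to G$ restricts to a bijection $\mathcal N\to G$; $y_g\in\mathcal N$ denotes the normal form of $g$. The edge $e_{g,a}$ is degenerate if $y_ga=y_{ga}$ or $y_g=y_{ga}a^{-1}$ as words. Let $\vec E_d$ be the set of degenerate edges and $\vec E_r=\vec E\setminus\vec E_d$. Stackable. $G$ is stackable over $A$ with stackable structure $(\mathcal N,<,k)$ if $\mathcal N$ is a set of normal forms for $G$ over $A$ containing the empty word, $<$ is a well-founded strict partial ordering on $\vec E_r$, and $k$ is a constant, such that for every $g\in G$ and $a\in A$ there is a path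 $p$ from $g$ to $ga$ in $\Gamma$ of length at most $k$ such that whenever $e'$ is a directed edge in the path $p$, either $e',e_{g,a}\in\vec E_r$ and $e'<e_{g,a}$, or else $e'\in\vec E_d$. Stacking map. A stacking map for $(\mathcal N,<,k)$ is a function $\phi:\vec E_r\to A^*$ obtained by choosing, for each $e_{g,a}\in\vec E_r$, a word $\phi(e_{g,a})=a_1\cdots a_n$ (each $a_i\in A$) with $\phi(e_{g,a})=_Ga$, $n\le k$, and, for each $i$, either $e_{ga_1\cdots a_{i-1},a_i}\in\vec E_d$, or else $e_{ga_1\cdots a_{i-1},a_i}\in\vec E_r$ and $e_{ga_1\cdots a_{i-1},a_i}<e_{g,a}$. Stacking relation set. $R_\phi$ is the closure of the set of words $\{\phi(e_{g,a})a^{-1}\mid g\in G,\ a\in A,\ e_{g,a}\in\vec E_r\}$ under inversion, cyclic conjugation, and free reduction (except the empty word). *)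

theory Defs
  imports
    "HOL-Algebra.Generated_Groups"
    "HOL-Library.Sublist"
    "Graph_Theory.Arc_Walk"
begin

section \<open>Words over a symmetric generating set\<close>

text \<open>
  Words over \<open>A\<close> are the elements of \<^term>\<open>lists A\<close>.  Since \<open>A\<close> is a subset of the group, the
  letter inverse to \<open>a\<close> is the group element \<open>inv a\<close>; in particular a letter of order two is
  its own inverse letter.
\<close>

definition symmetric_generating_set :: "('a, 'm) monoid_scheme \<Rightarrow> 'a set \<Rightarrow> bool" where
  "symmetric_generating_set G A \<longleftrightarrow>
     A \<subseteq> carrier G \<and> (\<forall>a\<in>A. inv\<^bsub>G\<^esub> a \<in> A) \<and> generate G A = carrier G"

definition word_value :: "('a, 'm) monoid_scheme \<Rightarrow> 'a list \<Rightarrow> 'a" where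
  "word_value G w = foldr (\<otimes>\<^bsub>G\<^esub>) w \<one>\<^bsub>G\<^esub>"

definition inv_word :: "('a \<Rightarrow> 'a) \<Rightarrow> 'a list \<Rightarrow> 'a list" where
  "inv_word bar w = rev (map bar w)"

section \<open>Group presentations over an alphabet with inverse letters\<close>

text \<open>In this section \<open>bar a\<close> is the inverse letter of \<open>a\<close>.\<close>

definition cancel_step :: "'a set \<Rightarrow> ('a \<Rightarrow> 'a) \<Rightarrow> ('a list \<times> 'a list) set" where
  "cancel_step A bar =
     {(u @ [a, bar a] @ v, u @ v) | u a v. u \<in> lists A \<and> a \<in> A \<and> v \<in> lists A}"

definition free_equiv :: "'a set \<Rightarrow> ('a \<Rightarrow> 'a) \<Rightarrow> ('a list \<times> 'a list) set" where
  "free_equiv A bar =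
     (cancel_step A bar \<union> (cancel_step A bar)\<inverse>)\<^sup>* \<inter> (lists A \<times> lists A)"

definition free_class :: "'a set \<Rightarrow> ('a \<Rightarrow> 'a) \<Rightarrow> 'a list \<Rightarrow> 'a list set" where
  "free_class A bar w = free_equiv A bar `` {w}"

text \<open>
  The group freely generated by \<open>A\<close> subject only to the convention that the letter \<open>bar a\<close> is the
  inverse of the letter \<open>a\<close>, for every \<open>a \<in> A\<close>: words modulo insertion and deletion of
  \<open>a (bar a)\<close>.
\<close>

definition free_group :: "'a set \<Rightarrow> ('a \<Rightarrow> 'a) \<Rightarrow> 'a list set monoid" where
  "free_group A bar =
     \<lparr> carrier = lists A // free_equiv A bar,
       monoid.mult = (\<lambda>X Y. \<Union>u\<in>X. \<Union>v\<in>Y. free_class A bar (u @ v)),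
       one = free_class A bar [] \<rparr>"

definition normal_closure :: "('a, 'm) monoid_scheme \<Rightarrow> 'a set \<Rightarrow> 'a set" where
  "normal_closure F S = \<Inter>{N. N \<lhd> F \<and> S \<subseteq> N}"

definition relator_subgroup ::
  "'a set \<Rightarrow> ('a \<Rightarrow> 'a) \<Rightarrow> 'a list set \<Rightarrow> 'a list set set" where
  "relator_subgroup A bar R = normal_closure (free_group A bar) (free_class A bar ` R)"

definition presented_group ::
  "'a set \<Rightarrow> ('a \<Rightarrow> 'a) \<Rightarrow> 'a list set \<Rightarrow> 'a list set set monoid" where
  "presented_group A bar R = free_group A bar Mod relator_subgroup A bar R"

text \<open>
  \<open>G\<close> has the presentation with generators \<open>A\<close> and relators \<open>R\<close>, via the canonical map: the
  isomorphism sends the class of the one-letter word \<open>[a]\<close> to the group element \<open>a\<close>.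
\<close>

definition finitely_presented_by ::
  "('a, 'm) monoid_scheme \<Rightarrow> 'a set \<Rightarrow> 'a list set \<Rightarrow> bool" where
  "finitely_presented_by G A R \<longleftrightarrow>
     finite A \<and> finite R \<and> R \<subseteq> lists A \<and>
     (\<exists>h \<in> iso (presented_group A (m_inv G) R) G.
        \<forall>a\<in>A. h (relator_subgroup A (m_inv G) R
                  #>\<^bsub>free_group A (m_inv G)\<^esub> free_class A (m_inv G) [a]) = a)"

section \<open>Cayley graphs and normal forms\<close>

text \<open>The pair \<open>(g, a)\<close> is the directed edge with initial vertex \<open>g\<close> and label \<open>a\<close>.\<close>

definition cayley_graph :: "('a, 'm) monoid_scheme \<Rightarrow> 'a set \<Rightarrow> ('a, 'a \<times> 'a) pre_digraph" where
  "cayley_graph G A =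
     \<lparr> verts = carrier G, arcs = carrier G \<times> A,
       tail = (\<lambda>(g, a). g), head = (\<lambda>(g, a). g \<otimes>\<^bsub>G\<^esub> a) \<rparr>"

definition normal_form_set ::
  "('a, 'm) monoid_scheme \<Rightarrow> 'a set \<Rightarrow> 'a list set \<Rightarrow> bool" where
  "normal_form_set G A \<N> \<longleftrightarrow>
     \<N> \<subseteq> lists A \<and> bij_betw (word_value G) \<N> (carrier G)"

definition normal_form :: "('a, 'm) monoid_scheme \<Rightarrow> 'a list set \<Rightarrow> 'a \<Rightarrow> 'a list" where
  "normal_form G \<N> g = the_inv_into \<N> (word_value G) g"

definition degenerate_edges ::
  "('a, 'm) monoid_scheme \<Rightarrow> 'a set \<Rightarrow> 'a list set \<Rightarrow> ('a \<times> 'a) set" where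
  "degenerate_edges G A \<N> =
     {(g, a) \<in> arcs (cayley_graph G A).
        normal_form G \<N> g @ [a] = normal_form G \<N> (g \<otimes>\<^bsub>G\<^esub> a) \<or>
        normal_form G \<N> g = normal_form G \<N> (g \<otimes>\<^bsub>G\<^esub> a) @ [inv\<^bsub>G\<^esub> a]}"

definition recursive_edges ::
  "('a, 'm) monoid_scheme \<Rightarrow> 'a set \<Rightarrow> 'a list set \<Rightarrow> ('a \<times> 'a) set" where
  "recursive_edges G A \<N> = arcs (cayley_graph G A) - degenerate_edges G A \<N>"

section \<open>Stackable structures, stacking maps and stacking relations\<close>

text \<open>The relation \<open>lt\<close> contains \<open>(e', e)\<close> iff \<open>e' < e\<close>.\<close>

definition stackable_structure ::
  "('a, 'm) monoid_scheme \<Rightarrow> 'a set \<Rightarrow> 'a list set \<Rightarrow> ('a \<times> 'a) rel \<Rightarrow> nat \<Rightarrow> bool" where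
  "stackable_structure G A \<N> lt k \<longleftrightarrow>
     normal_form_set G A \<N> \<and> [] \<in> \<N> \<and>
     lt \<subseteq> recursive_edges G A \<N> \<times> recursive_edges G A \<N> \<and>
     irrefl lt \<and> trans lt \<and> wf lt \<and>
     (\<forall>g \<in> carrier G. \<forall>a \<in> A. \<exists>p.
        pre_digraph.awalk (cayley_graph G A) g p (g \<otimes>\<^bsub>G\<^esub> a) \<and> length p \<le> k \<and>
        (\<forall>e' \<in> set p.
           (e' \<in> recursive_edges G A \<N> \<and> (g, a) \<in> recursive_edges G A \<N> \<and> (e', (g, a)) \<in> lt) \<or>
           e' \<in> degenerate_edges G A \<N>))"

text \<open>Only the values of \<open>\<phi>\<close> on recursive edges are relevant.\<close>

definition stacking_map ::
  "('a, 'm) monoid_scheme \<Rightarrow> 'a set \<Rightarrow> 'a list set \<Rightarrow> ('a \<times> 'a) rel \<Rightarrow> nat \<Rightarrow>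
   ('a \<times> 'a \<Rightarrow> 'a list) \<Rightarrow> bool" where
  "stacking_map G A \<N> lt k \<phi> \<longleftrightarrow>
     (\<forall>(g, a) \<in> recursive_edges G A \<N>.
        \<phi> (g, a) \<in> lists A \<and> word_value G (\<phi> (g, a)) = a \<and> length (\<phi> (g, a)) \<le> k \<and>
        (\<forall>i < length (\<phi> (g, a)).
           let e' = (g \<otimes>\<^bsub>G\<^esub> word_value G (take i (\<phi> (g, a))), \<phi> (g, a) ! i) in
           e' \<in> degenerate_edges G A \<N> \<or>
           (e' \<in> recursive_edges G A \<N> \<and> (e', (g, a)) \<in> lt)))"

text \<open>
  Free reduction is closed up one cancellation at a time, so the closure contains the partially
  as well as the fully reduced words.
\<close>

inductive_set relator_closure :: "'a set \<Rightarrow> ('a \<Rightarrow> 'a) \<Rightarrow> 'a list set \<Rightarrow> 'a list set"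
  for A :: "'a set" and bar :: "'a \<Rightarrow> 'a" and S :: "'a list set" where
  base: "w \<in> S \<Longrightarrow> w \<in> relator_closure A bar S"
| inversion: "w \<in> relator_closure A bar S \<Longrightarrow> inv_word bar w \<in> relator_closure A bar S"
| cyclic: "u @ v \<in> relator_closure A bar S \<Longrightarrow> v @ u \<in> relator_closure A bar S"
| reduction: "v \<in> relator_closure A bar S \<Longrightarrow> (v, w) \<in> cancel_step A bar \<Longrightarrow>
    w \<in> relator_closure A bar S"

definition stacking_relations ::
  "('a, 'm) monoid_scheme \<Rightarrow> 'a set \<Rightarrow> 'a list set \<Rightarrow> ('a \<times> 'a \<Rightarrow> 'a list) \<Rightarrow> 'a list set" where
  "stacking_relations G A \<N> \<phi> =
     relator_closure A (m_inv G)
       {\<phi> (g, a) @ [inv\<^bsub>G\<^esub> a] | g a. (g, a) \<in> recursive_edges G A \<N>} - {[]}"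

end

theory Submission
  imports Defs
begin

text \<open>
  Both claims are obtained by the same well-founded propagation.  To show that a property of
  labelled paths in the Cayley graph holds for all paths, it is enough that it holds for empty
  paths, that it is inherited when an edge is appended, that it holds for degenerate edges, and
  that it passes from the path \<open>\<phi> e\<close> to the recursive edge \<open>e\<close> which that path bypasses.  Indeed
  every edge of \<open>\<phi> e\<close> is degenerate or smaller than \<open>e\<close>, so well-founded induction gives the
  property for every edge.  This is the lemma \<open>path_induct\<close>.

  For prefix closure, call a vertex good if every prefix of its normal form is a normal form,
  and propagate the property that a path with a good initial vertex has a good terminal vertex.
  Along a degenerate edge the normal form gains or loses its last letter, so goodness survives;
  a recursive edge joins the endpoints of \<open>\<phi> e\<close>.  The vertex \<open>\<one>\<close> is good because its normal form
  is empty, and every vertex can be reached from it (\<open>prefixes_of_nf\<close>).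

  For the presentation, let \<open>f\<close> be a monoid homomorphism from words to a group that respects
  inverse letters and kills the stacking relations.  Propagating
  \<open>f (y\<^sub>g) f w = f (y\<^sub>h)\<close>, where \<open>y\<^sub>g\<close> is the normal form of \<open>g\<close> and \<open>h\<close> is the end of the path \<open>w\<close> from \<open>g\<close>, and
  then taking \<open>g = \<one>\<close> gives \<open>f w = f (y\<^sub>h)\<close> with \<open>h\<close> the value of \<open>w\<close>
  (\<open>word_map_factors\<close>).  In particular a word of value \<open>\<one>\<close> is killed by \<open>f\<close>.  Applied to
  the quotients of the free group by normal subgroups containing the relators, this says that the
  kernel of evaluation lies in the normal closure of the relators.  The reverse inclusion holds
  because relators have value \<open>\<one>\<close>, and the first isomorphism theorem finishes the argument
  (\<open>finitely_presented_byI\<close>).  There are finitely many relators: inversion and cyclic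
  conjugation preserve length and free reduction decreases it, so all have length at most
  \<open>k + 1\<close>.
\<close>

section \<open>The free group on an alphabet with inverse letters\<close>

locale involutive_alphabet =
  fixes A :: "'a set" and bar :: "'a \<Rightarrow> 'a"
  assumes bar_closed: "a \<in> A \<Longrightarrow> bar a \<in> A"
    and bar_bar: "a \<in> A \<Longrightarrow> bar (bar a) = a"
begin

abbreviation "E \<equiv> free_equiv A bar"
abbreviation "cls \<equiv> free_class A bar"
abbreviation "F \<equiv> free_group A bar"

lemma cancel_step_lists:
  "(u, v) \<in> cancel_step A bar \<Longrightarrow> u \<in> lists A \<and> v \<in> lists A"
  by (auto simp: cancel_step_def bar_closed)

lemma equiv_free_equiv: "equiv (lists A) E"
proof (rule equivI)
  show "refl_on (lists A) E"
    by (auto simp: refl_on_def free_equiv_def)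
  show "sym E"
    unfolding free_equiv_def
    by (intro sym_Int sym_rtrancl) (auto simp: sym_def)
  show "trans E"
    unfolding free_equiv_def
    by (intro trans_Int trans_rtrancl) (auto simp: trans_def)
qed (auto simp: free_equiv_def)

lemma cancel_step_append:
  assumes "(u, v) \<in> cancel_step A bar" "x \<in> lists A" "y \<in> lists A"
  shows "(x @ u @ y, x @ v @ y) \<in> cancel_step A bar"
proof -
  obtain p a q where "u = p @ [a, bar a] @ q" "v = p @ q" "p \<in> lists A" "a \<in> A" "q \<in> lists A"
    using assms(1) by (auto simp: cancel_step_def)
  then have "x @ u @ y = (x @ p) @ [a, bar a] @ (q @ y)" "x @ v @ y = (x @ p) @ (q @ y)"
    "x @ p \<in> lists A" "q @ y \<in> lists A"
    using assms by auto
  then show ?thesis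
    using \<open>a \<in> A\<close> unfolding cancel_step_def by blast
qed

lemma free_equiv_context:
  assumes "(u, v) \<in> E" "x \<in> lists A" "y \<in> lists A"
  shows "(x @ u @ y, x @ v @ y) \<in> E"
proof -
  let ?S = "cancel_step A bar \<union> (cancel_step A bar)\<inverse>"
  have "(u, v) \<in> ?S\<^sup>*" "u \<in> lists A" "v \<in> lists A"
    using assms(1) by (auto simp: free_equiv_def)
  have "(x @ u @ y, x @ v @ y) \<in> ?S\<^sup>*"
    using \<open>(u, v) \<in> ?S\<^sup>*\<close>
  proof induction
    case (step v w)
    then have "(x @ v @ y, x @ w @ y) \<in> ?S"
      using cancel_step_append assms by blast
    with step show ?case
      by (meson rtrancl.rtrancl_into_rtrancl)
  qed simp
  then show ?thesis
    using assms \<open>u \<in> lists A\<close> \<open>v \<in> lists A\<close> by (auto simp: free_equiv_def)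
qed

lemma free_equiv_append:
  assumes "(u, u') \<in> E" "(v, v') \<in> E"
  shows "(u @ v, u' @ v') \<in> E"
proof -
  have "v \<in> lists A" "u' \<in> lists A"
    using assms by (auto simp: free_equiv_def)
  then have "(u @ v, u' @ v) \<in> E" "(u' @ v, u' @ v') \<in> E"
    using free_equiv_context[OF assms(1), of "[]" v] free_equiv_context[OF assms(2), of u' "[]"]
    by auto
  then show ?thesis
    using equiv_free_equiv by (meson equivE transE)
qed

lemma free_class_eq_iff:
  "u \<in> lists A \<Longrightarrow> v \<in> lists A \<Longrightarrow> cls u = cls v \<longleftrightarrow> (u, v) \<in> E"
  unfolding free_class_def by (rule eq_equiv_class_iff[OF equiv_free_equiv])

lemma free_class_closed: "u \<in> lists A \<Longrightarrow> cls u \<in> carrier F"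
  by (auto simp: free_group_def free_class_def quotient_def)

lemma free_group_carrierE:
  assumes "X \<in> carrier F"
  obtains u where "u \<in> lists A" "X = cls u"
  using assms by (auto simp: free_group_def free_class_def quotient_def)

text \<open>
  Equivalence is a congruence for concatenation, so all the classes in the union that defines
  the product coincide.
\<close>

lemma free_class_append:
  assumes "u \<in> lists A" "v \<in> lists A"
  shows "cls u \<otimes>\<^bsub>F\<^esub> cls v = cls (u @ v)"
proof -
  have *: "cls (u' @ v') = cls (u @ v)" if "u' \<in> cls u" "v' \<in> cls v" for u' v'
  proof -
    have "(u @ v, u' @ v') \<in> E"
      using that free_equiv_append by (auto simp: free_class_def)
    then show ?thesis
      unfolding free_class_def using equiv_class_eq[OF equiv_free_equiv] by metis
  qed
  have "u \<in> cls u" "v \<in> cls v"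
    using assms equiv_class_self[OF equiv_free_equiv] by (auto simp: free_class_def)
  then have "(\<Union>u'\<in>cls u. \<Union>v'\<in>cls v. cls (u' @ v')) = cls (u @ v)"
    using * by blast
  then show ?thesis
    by (simp add: free_group_def)
qed

lemma free_class_one: "\<one>\<^bsub>F\<^esub> = cls []"
  by (simp add: free_group_def)

lemma free_class_cancel_step:
  assumes "(u, v) \<in> cancel_step A bar"
  shows "cls u = cls v"
  using assms cancel_step_lists[OF assms]
  by (subst free_class_eq_iff) (auto simp: free_equiv_def)

lemma free_class_cancel:
  assumes "a \<in> A" shows "cls [a, bar a] = cls []"
  using assms by (intro free_class_cancel_step) (force simp: cancel_step_def)

lemma group_free_group: "group F"
proof (rule groupI)
  show "\<one>\<^bsub>F\<^esub> \<in> carrier F"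
    by (simp add: free_class_one free_class_closed)
  show "x \<otimes>\<^bsub>F\<^esub> y \<in> carrier F" if "x \<in> carrier F" "y \<in> carrier F" for x y
    using that by (elim free_group_carrierE) (simp add: free_class_append free_class_closed)
  show "x \<otimes>\<^bsub>F\<^esub> y \<otimes>\<^bsub>F\<^esub> z = x \<otimes>\<^bsub>F\<^esub> (y \<otimes>\<^bsub>F\<^esub> z)"
    if "x \<in> carrier F" "y \<in> carrier F" "z \<in> carrier F" for x y z
    using that by (elim free_group_carrierE) (simp add: free_class_append)
  show "\<one>\<^bsub>F\<^esub> \<otimes>\<^bsub>F\<^esub> x = x" if "x \<in> carrier F" for x
    using that by (elim free_group_carrierE) (simp add: free_class_append free_class_one)
  \<comment> \<open>The inverse word is built letter by letter: \<open>v @ [bar a]\<close> is a left inverse of \<open>a # u\<close>,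
    since \<open>a = bar (bar a)\<close> cancels against the preceding \<open>bar a\<close>.\<close>
  have "\<exists>v\<in>lists A. cls (v @ u) = cls []" if "u \<in> lists A" for u
    using that
  proof (induction u)
    case (Cons a u)
    then obtain v where v: "v \<in> lists A" "cls (v @ u) = cls []"
      by auto
    have "(v @ [bar a, bar (bar a)] @ u, v @ u) \<in> cancel_step A bar"
      using Cons v bar_closed unfolding cancel_step_def by blast
    then have "cls ((v @ [bar a]) @ a # u) = cls (v @ u)"
      using free_class_cancel_step bar_bar Cons.hyps by fastforce
    moreover have "v @ [bar a] \<in> lists A"
      using v Cons.hyps bar_closed by auto
    ultimately show ?case
      using v(2) by metis
  qed auto
  then show "\<exists>y\<in>carrier F. y \<otimes>\<^bsub>F\<^esub> x = \<one>\<^bsub>F\<^esub>" if "x \<in> carrier F" for x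
    using that
    by (elim free_group_carrierE) (metis free_class_append free_class_closed free_class_one)
qed

end

lemma (in group) normal_closure_normal:
  assumes "S \<subseteq> carrier G"
  shows "normal_closure G S \<lhd> G"
proof -
  let ?\<A> = "{N. N \<lhd> G \<and> S \<subseteq> N}"
  \<comment> \<open>The whole group keeps the intersected family from being empty; an empty intersection
    would be the universe of the type instead of a subgroup.\<close>
  have "carrier G \<lhd> G"
    by (simp add: normal_inv_iff subgroup_self)
  then have "carrier G \<in> ?\<A>"
    using assms by blast
  then have "subgroup (\<Inter>?\<A>) G"
    by (intro subgroups_Inter) (auto intro: normal_imp_subgroup)
  moreover have "x \<otimes> h \<otimes> inv x \<in> \<Inter>?\<A>" if "x \<in> carrier G" "h \<in> \<Inter>?\<A>" for x h
    using that by (auto intro: normal.inv_op_closed2)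
  ultimately show ?thesis
    unfolding normal_closure_def normal_inv_iff by blast
qed

section \<open>Words over a symmetric subset of a group\<close>

locale group_alphabet = group G for G :: "('a, 'm) monoid_scheme" (structure) +
  fixes A :: "'a set"
  assumes letters_closed: "A \<subseteq> carrier G"
    and inv_letter: "a \<in> A \<Longrightarrow> inv a \<in> A"
begin

sublocale involutive_alphabet A "m_inv G"
  using letters_closed by unfold_locales (auto simp: inv_letter)

abbreviation "val \<equiv> word_value G"

lemma val_Nil [simp]: "val [] = \<one>"
  by (simp add: word_value_def)

lemma val_Cons [simp]: "val (a # w) = a \<otimes> val w"
  by (simp add: word_value_def)

lemma val_closed [simp]: "w \<in> lists A \<Longrightarrow> val w \<in> carrier G"
  using letters_closed by (induction w) auto

lemma val_append:
  "u \<in> lists A \<Longrightarrow> v \<in> lists A \<Longrightarrow> val (u @ v) = val u \<otimes> val v"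
  using letters_closed by (induction u) (auto simp: m_assoc subset_iff)

lemma val_snoc: "w \<in> lists A \<Longrightarrow> a \<in> A \<Longrightarrow> val (w @ [a]) = val w \<otimes> a"
  using letters_closed by (auto simp: val_append)

lemma val_cancel_step:
  assumes "(u, v) \<in> cancel_step A (m_inv G)"
  shows "val u = val v"
proof -
  obtain p a q where pq: "u = p @ [a, inv a] @ q" "v = p @ q" "p \<in> lists A" "a \<in> A" "q \<in> lists A"
    using assms by (auto simp: cancel_step_def)
  then have "a \<in> carrier G"
    using letters_closed by blast
  then have "val ([a, inv a] @ q) = val q"
    using pq by (simp add: m_assoc[symmetric])
  moreover have "[a, inv a] @ q \<in> lists A"
    using pq inv_letter by auto
  ultimately show ?thesis
    using pq by (simp only: val_append)
qed

lemma val_free_equiv: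
  assumes "(u, v) \<in> E" shows "val u = val v"
proof -
  have "(u, v) \<in> (cancel_step A (m_inv G) \<union> (cancel_step A (m_inv G))\<inverse>)\<^sup>*"
    using assms by (simp add: free_equiv_def)
  then show ?thesis
    by induction (auto dest: val_cancel_step)
qed

text \<open>
  The evaluation homomorphism from the free group.  Equivalent words have equal value, so the image
  of a class is a singleton.
\<close>

definition class_val :: "'a list set \<Rightarrow> 'a" where
  "class_val X = the_elem (val ` X)"

lemma class_val_free_class:
  assumes "u \<in> lists A" shows "class_val (cls u) = val u"
proof -
  have "u \<in> cls u"
    using assms equiv_class_self[OF equiv_free_equiv] by (simp add: free_class_def)
  moreover have "val v = val u" if "v \<in> cls u" for v
    using that val_free_equiv by (auto simp: free_class_def)
  ultimately have "val ` cls u = {val u}"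
    by blast
  then show ?thesis
    by (simp add: class_val_def)
qed

lemma group_hom_class_val: "group_hom F G class_val"
proof -
  have "class_val \<in> hom F G"
    by (rule homI; elim free_group_carrierE)
      (auto simp: class_val_free_class free_class_append val_append)
  then show ?thesis
    by (simp add: group_hom_def group_hom_axioms_def group_free_group is_group)
qed

text \<open>
  The kernel of evaluation contains the normal closure of the relators because it is normal and
  relators evaluate to \<open>\<one>\<close>.  The assumption \<open>trivial\<close> is the other inclusion: testing membership in
  each normal subgroup above the relators separately allows it to be checked in one quotient
  group at a time.
\<close>

theorem finitely_presented_byI:
  assumes "finite A" "finite R" "R \<subseteq> lists A"
    and surj: "carrier G \<subseteq> val ` lists A"
    and relators: "\<And>r. r \<in> R \<Longrightarrow> val r = \<one>"
    and trivial: "\<And>N w. N \<lhd> F \<Longrightarrow> cls ` R \<subseteq> N \<Longrightarrow> w \<in> lists A \<Longrightarrow> val w = \<one> \<Longrightarrow> cls w \<in> N"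
  shows "finitely_presented_by G A R"
proof -
  interpret F: group F by (rule group_free_group)
  interpret ev: group_hom F G class_val by (rule group_hom_class_val)
  let ?K = "kernel F G class_val"
  have "cls ` R \<subseteq> carrier F"
    using \<open>R \<subseteq> lists A\<close> free_class_closed by blast
  have "cls ` R \<subseteq> ?K"
    using \<open>R \<subseteq> lists A\<close> relators
    by (auto simp: kernel_def class_val_free_class free_class_closed subset_iff)
  have K: "relator_subgroup A (m_inv G) R = ?K"
  proof
    show "relator_subgroup A (m_inv G) R \<subseteq> ?K"
      unfolding relator_subgroup_def normal_closure_def
      using ev.normal_kernel \<open>cls ` R \<subseteq> ?K\<close> by blast
    show "?K \<subseteq> relator_subgroup A (m_inv G) R"
    proof
      fix X assume "X \<in> ?K"
      then obtain w where w: "X = cls w" "w \<in> lists A" "val w = \<one>"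
        unfolding kernel_def by (metis (mono_tags, lifting) class_val_free_class
            free_group_carrierE mem_Collect_eq)
      then show "X \<in> relator_subgroup A (m_inv G) R"
        unfolding relator_subgroup_def normal_closure_def using trivial by blast
    qed
  qed
  have "class_val ` carrier F = carrier G"
  proof
    show "carrier G \<subseteq> class_val ` carrier F"
      using surj by (auto simp: image_iff subset_iff) (metis class_val_free_class free_class_closed)
  qed auto
  then have iso: "(\<lambda>X. the_elem (class_val ` X)) \<in> iso (F Mod ?K) G"
    by (rule ev.FactGroup_iso_set)
  have "the_elem (class_val ` (?K #>\<^bsub>F\<^esub> cls [a])) = a" if "a \<in> A" for a
  proof -
    have a: "cls [a] \<in> carrier F" "class_val (cls [a]) = a" "a \<in> carrier G"
      using that letters_closed by (auto simp: free_class_closed class_val_free_class)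
    have coset_val: "class_val X = class_val (cls [a])" if "X \<in> ?K #>\<^bsub>F\<^esub> cls [a]" for X
      using that a by (auto simp: r_coset_def kernel_def)
    have "cls [a] \<in> ?K #>\<^bsub>F\<^esub> cls [a]"
      using a ev.subgroup_kernel by (intro F.rcos_self)
    then have "?K #>\<^bsub>F\<^esub> cls [a] \<noteq> {}"
      by (rule ex_in_conv[THEN iffD1, OF exI])
    then have "the_elem (class_val ` (?K #>\<^bsub>F\<^esub> cls [a])) = class_val (cls [a])"
      by (rule the_elem_image_unique) (rule coset_val)
    then show ?thesis
      using a(2) by simp
  qed
  then show ?thesis
    unfolding finitely_presented_by_def presented_group_def K
    using assms(1-3) by (intro conjI bexI[OF _ iso] ballI)
qed

lemma relator_closure_lists:
  assumes "w \<in> relator_closure A (m_inv G) S" "S \<subseteq> lists A"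
  shows "w \<in> lists A"
  using assms
proof induction
  case (inversion w)
  then show ?case
    by (auto simp: inv_word_def inv_letter)
next
  case (reduction v w)
  then show ?case
    using cancel_step_lists by blast
qed auto

lemma val_inv_word: "w \<in> lists A \<Longrightarrow> val (inv_word (m_inv G) w) = inv (val w)"
proof (induction w)
  case (Cons a w)
  then have "inv_word (m_inv G) w \<in> lists A" "a \<in> carrier G"
    using letters_closed by (auto simp: inv_word_def inv_letter)
  then show ?case
    using Cons letters_closed
    by (simp add: inv_word_def val_snoc inv_letter inv_mult_group)
qed (simp add: inv_word_def)

lemma val_relator_closure:
  assumes "w \<in> relator_closure A (m_inv G) S" "S \<subseteq> lists A" "\<And>s. s \<in> S \<Longrightarrow> val s = \<one>"
  shows "val w = \<one>"
  using assms
proof induction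
  case (inversion w)
  then show ?case
    using relator_closure_lists by (simp add: val_inv_word)
next
  case (cyclic u v)
  then have "u \<in> lists A" "v \<in> lists A"
    using relator_closure_lists[of "u @ v" S] by auto
  then show ?case
    using cyclic inv_comm[of "val u" "val v"] by (simp add: val_append)
next
  case (reduction v w)
  then show ?case
    using val_cancel_step by metis
qed

text \<open>No closure operation lengthens a word; this is what makes the set of relators finite.\<close>

lemma relator_closure_length:
  assumes "w \<in> relator_closure A (m_inv G) S" "\<And>s. s \<in> S \<Longrightarrow> length s \<le> n"
  shows "length w \<le> n"
  using assms by induction (auto simp: inv_word_def cancel_step_def)

end

section \<open>Propagation of path properties along a stacking map\<close>

locale stacking = group_alphabet +
  fixes \<N> :: "'a list set" and lt :: "('a \<times> 'a) rel" and k :: nat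
    and \<phi> :: "'a \<times> 'a \<Rightarrow> 'a list"
  assumes normal_form_set: "normal_form_set G A \<N>"
    and Nil_normal_form: "[] \<in> \<N>"
    and wf_lt: "wf lt"
    and stacking_map: "stacking_map G A \<N> lt k \<phi>"
begin

abbreviation "nf \<equiv> normal_form G \<N>"
abbreviation "R \<equiv> stacking_relations G A \<N> \<phi>"

lemma nf_in: "g \<in> carrier G \<Longrightarrow> nf g \<in> \<N>"
  using normal_form_set
  by (auto simp: normal_form_set_def normal_form_def bij_betw_def intro: the_inv_into_into)

lemma nf_lists: "g \<in> carrier G \<Longrightarrow> nf g \<in> lists A"
  using nf_in normal_form_set by (auto simp: normal_form_set_def)

lemma val_nf: "g \<in> carrier G \<Longrightarrow> val (nf g) = g"
  using normal_form_set
  by (auto simp: normal_form_set_def normal_form_def bij_betw_def intro: f_the_inv_into_f)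

lemma nf_val: "w \<in> \<N> \<Longrightarrow> nf (val w) = w"
  using normal_form_set
  by (auto simp: normal_form_set_def normal_form_def bij_betw_def intro: the_inv_into_f_f)

lemma nf_one: "nf \<one> = []"
  using nf_val[OF Nil_normal_form] by simp

lemma edge_cases:
  assumes "g \<in> carrier G" "a \<in> A"
  obtains "(g, a) \<in> recursive_edges G A \<N>" | "nf (g \<otimes> a) = nf g @ [a]"
    | "nf g = nf (g \<otimes> a) @ [inv a]"
proof -
  have "(g, a) \<in> recursive_edges G A \<N> \<or> nf g @ [a] = nf (g \<otimes> a)
      \<or> nf g = nf (g \<otimes> a) @ [inv a]"
    using assms by (auto simp: recursive_edges_def degenerate_edges_def cayley_graph_def)
  then show thesis
    using that by metis
qed

lemma recursive_edgeD:
  assumes "(g, a) \<in> recursive_edges G A \<N>"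
  shows "g \<in> carrier G" "a \<in> A" "\<phi> (g, a) \<in> lists A" "val (\<phi> (g, a)) = a"
    "length (\<phi> (g, a)) \<le> k"
proof -
  show "g \<in> carrier G" "a \<in> A"
    using assms by (auto simp: recursive_edges_def cayley_graph_def)
  show "\<phi> (g, a) \<in> lists A" "val (\<phi> (g, a)) = a" "length (\<phi> (g, a)) \<le> k"
    using stacking_map assms unfolding stacking_map_def by blast+
qed

text \<open>
  \<open>T g w\<close> is a property of the path that starts at \<open>g\<close> and has label \<open>w\<close>.  The first two rules
  reduce every path to its edges.  For single edges the induction is on \<open>lt\<close>: a degenerate edge
  is covered by \<open>forward\<close> or \<open>backward\<close>, and a recursive edge \<open>e\<close> by \<open>recursive\<close>, since the
  edges of the path labelled \<open>\<phi> e\<close> are degenerate or smaller than \<open>e\<close>.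
\<close>

lemma path_induct [consumes 2, case_names empty extend forward backward recursive]:
  assumes "g \<in> carrier G" "w \<in> lists A"
    and empty: "\<And>g. g \<in> carrier G \<Longrightarrow> T g []"
    and extend: "\<And>g u a. g \<in> carrier G \<Longrightarrow> u \<in> lists A \<Longrightarrow> a \<in> A \<Longrightarrow> T g u \<Longrightarrow>
      T (g \<otimes> val u) [a] \<Longrightarrow> T g (u @ [a])"
    and forward: "\<And>g a. g \<in> carrier G \<Longrightarrow> a \<in> A \<Longrightarrow> nf (g \<otimes> a) = nf g @ [a] \<Longrightarrow> T g [a]"
    and backward: "\<And>g a. g \<in> carrier G \<Longrightarrow> a \<in> A \<Longrightarrow> nf g = nf (g \<otimes> a) @ [inv a] \<Longrightarrow> T g [a]"
    and recursive: "\<And>g a. (g, a) \<in> recursive_edges G A \<N> \<Longrightarrow> T g (\<phi> (g, a)) \<Longrightarrow> T g [a]"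
  shows "T g w"
proof -
  have path: "T g w" if "g \<in> carrier G" "w \<in> lists A"
    "\<And>i. i < length w \<Longrightarrow> T (g \<otimes> val (take i w)) [w ! i]" for g w
    using that(2,3)
  proof (induction w rule: rev_induct)
    case Nil
    then show ?case using empty that(1) by simp
  next
    case (snoc a u)
    have "T (g \<otimes> val (take i u)) [u ! i]" if "i < length u" for i
      using snoc.prems(2)[of i] that by (simp add: nth_append)
    moreover have "T (g \<otimes> val u) [a]"
      using snoc.prems(2)[of "length u"] by simp
    ultimately show ?case
      using snoc that(1) by (intro extend) auto
  qed
  have edge: "fst e \<in> carrier G \<Longrightarrow> snd e \<in> A \<Longrightarrow> T (fst e) [snd e]" for e
    using wf_lt
  proof (induction e rule: wf_induct_rule)
    case (less e)
    obtain g a where e: "e = (g, a)" by fastforce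
    then have ga: "g \<in> carrier G" "a \<in> A" using less.prems by auto
    then show ?case
    proof (cases rule: edge_cases)
      case 1
      let ?w = "\<phi> (g, a)"
      note D = recursive_edgeD[OF 1]
      have "T (g \<otimes> val (take i ?w)) [?w ! i]" if i: "i < length ?w" for i
      proof -
        let ?h = "g \<otimes> val (take i ?w)" and ?b = "?w ! i"
        have "take i ?w \<in> lists A" "?b \<in> A"
          using D(3) i by (auto dest: in_set_takeD)
        then have hb: "?h \<in> carrier G" "?b \<in> A"
          using ga by auto
        have "(?h, ?b) \<in> degenerate_edges G A \<N> \<or> ((?h, ?b), (g, a)) \<in> lt"
          using stacking_map 1 i unfolding stacking_map_def Let_def by blast
        then show ?thesis
        proof
          assume "(?h, ?b) \<in> degenerate_edges G A \<N>"
          then show ?thesis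
            using forward backward hb by (auto simp: degenerate_edges_def)
        next
          assume "((?h, ?b), (g, a)) \<in> lt"
          then show ?thesis
            using less.IH[of "(?h, ?b)"] e hb by simp
        qed
      qed
      then have "T g ?w"
        using path ga D by blast
      then show ?thesis
        using recursive 1 e by simp
    qed (use e ga forward backward in auto)
  qed
  show ?thesis
  proof (rule path)
    fix i assume i: "i < length w"
    then have "take i w \<in> lists A" "w ! i \<in> A"
      using assms(2) by (auto dest: in_set_takeD)
    then show "T (g \<otimes> val (take i w)) [w ! i]"
      using edge[of "(g \<otimes> val (take i w), w ! i)"] assms(1) by simp
  qed fact+
qed

section \<open>Prefix closure of the normal forms\<close>

text \<open>
  A forward edge adds one prefix to the normal form, namely the whole normal form of its end; a
  backward edge only removes prefixes; the path \<open>\<phi> (g, a)\<close> has the same endpoints as the edge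
  \<open>(g, a)\<close>.  So the property \<open>P\<close> below spreads from \<open>\<one>\<close> to the whole group.
\<close>

lemma prefixes_of_nf:
  assumes "g \<in> carrier G" "prefix u (nf g)"
  shows "u \<in> \<N>"
proof -
  define P where "P g \<longleftrightarrow> (\<forall>u. prefix u (nf g) \<longrightarrow> u \<in> \<N>)" for g
  have "P h \<longrightarrow> P (h \<otimes> val w)" if "h \<in> carrier G" "w \<in> lists A" for h w
    using that
  proof (induction rule: path_induct)
    case (empty g)
    then show ?case by simp
  next
    case (extend g u a)
    then show ?case
      using letters_closed by (auto simp: val_snoc m_assoc subset_iff)
  next
    case (forward g a)
    then have "g \<otimes> a \<in> carrier G" "a \<in> carrier G"
      using letters_closed by auto
    then show ?case
      using forward nf_in[of "g \<otimes> a"] by (auto simp: P_def)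
  next
    case (backward g a)
    then have "a \<in> carrier G"
      using letters_closed by auto
    then show ?case
      using backward by (auto simp: P_def)
  next
    case (recursive g a)
    then show ?case
      using recursive_edgeD[OF recursive(1)] letters_closed by auto
  qed
  moreover have "P \<one>"
    using Nil_normal_form by (simp add: P_def nf_one)
  ultimately have "P (\<one> \<otimes> val (nf g))"
    using assms nf_lists by blast
  then show ?thesis
    using assms by (simp add: P_def val_nf)
qed

section \<open>The presentation by the stacking relations\<close>

lemma stacking_relators:
  "{\<phi> (g, a) @ [inv a] | g a. (g, a) \<in> recursive_edges G A \<N>} \<subseteq> lists A"
  using recursive_edgeD(2,3) inv_letter by fastforce

lemma stacking_relations_lists: "R \<subseteq> lists A"
  using relator_closure_lists[OF _ stacking_relators] by (auto simp: stacking_relations_def)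

lemma val_stacking_relations:
  assumes "r \<in> R" shows "val r = \<one>"
proof (rule val_relator_closure[OF _ stacking_relators])
  show "val s = \<one>"
    if s: "s \<in> {\<phi> (g, a) @ [inv a] | g a. (g, a) \<in> recursive_edges G A \<N>}" for s
  proof -
    obtain g a where "s = \<phi> (g, a) @ [inv a]" "(g, a) \<in> recursive_edges G A \<N>"
      using s by blast
    then show ?thesis
      using recursive_edgeD[of g a] letters_closed by (auto simp: val_snoc inv_letter)
  qed
qed (use assms in \<open>simp add: stacking_relations_def\<close>)

lemma finite_stacking_relations:
  assumes "finite A" shows "finite R"
proof (rule finite_subset)
  show "finite {w. set w \<subseteq> A \<and> length w \<le> Suc k}"
    by (rule finite_lists_length_le[OF assms])
  have "length r \<le> Suc k" if "r \<in> R" for r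
    using that recursive_edgeD(5)
    by (auto simp: stacking_relations_def elim!: relator_closure_length)
  then show "R \<subseteq> {w. set w \<subseteq> A \<and> length w \<le> Suc k}"
    using stacking_relations_lists by auto
qed

text \<open>
  The path from \<open>\<one>\<close> labelled \<open>w\<close> can be tracked by normal forms inside \<open>Q\<close>: degenerate edges
  preserve \<open>f (nf g) \<otimes> f w = f (nf (g \<otimes> val w))\<close> by appending or cancelling one letter, and for
  a recursive edge the relator \<open>\<phi> (g, a) @ [inv a]\<close> makes \<open>f (\<phi> (g, a))\<close> and \<open>f [a]\<close> equal.
\<close>

lemma word_map_factors:
  assumes "group Q"
    and closed: "\<And>w. w \<in> lists A \<Longrightarrow> f w \<in> carrier Q"
    and append: "\<And>u v. u \<in> lists A \<Longrightarrow> v \<in> lists A \<Longrightarrow> f (u @ v) = f u \<otimes>\<^bsub>Q\<^esub> f v"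
    and cancel: "\<And>a. a \<in> A \<Longrightarrow> f [a, inv a] = \<one>\<^bsub>Q\<^esub>"
    and relators: "\<And>r. r \<in> R \<Longrightarrow> f r = \<one>\<^bsub>Q\<^esub>"
    and w: "w \<in> lists A"
  shows "f w = f (nf (val w))"
proof -
  interpret Q: group Q by fact
  have f_Nil: "f [] = \<one>\<^bsub>Q\<^esub>"
    using append[of "[]" "[]"] closed[of "[]"] by simp
  have f_inv: "f [a] \<otimes>\<^bsub>Q\<^esub> f [inv a] = \<one>\<^bsub>Q\<^esub>" if "a \<in> A" for a
    using append[of "[a]" "[inv a]"] cancel[OF that] inv_letter[OF that] that by simp
  have "f (nf g) \<otimes>\<^bsub>Q\<^esub> f w = f (nf (g \<otimes> val w))" if "g \<in> carrier G" "w \<in> lists A" for g w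
    using that
  proof (induction rule: path_induct)
    case (empty g)
    then show ?case
      by (simp add: f_Nil closed nf_lists)
  next
    case (extend g u a)
    then have "a \<in> carrier G" using letters_closed by blast
    then show ?case
      using extend
      by (simp add: append val_snoc closed nf_lists Q.m_assoc[symmetric]) (simp add: m_assoc)
  next
    case (forward g a)
    then have "a \<in> carrier G" using letters_closed by blast
    then show ?case
      using forward append[of "nf g" "[a]"] by (simp add: nf_lists)
  next
    case (backward g a)
    then have a: "a \<in> carrier G" using letters_closed by blast
    have "f (nf g) = f (nf (g \<otimes> a)) \<otimes>\<^bsub>Q\<^esub> f [inv a]"
      using backward a append[of "nf (g \<otimes> a)" "[inv a]"] by (simp add: nf_lists inv_letter)
    moreover have "f [inv a] \<otimes>\<^bsub>Q\<^esub> f [a] = \<one>\<^bsub>Q\<^esub>"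
      using f_inv[of "inv a"] backward a by (simp add: inv_letter)
    ultimately show ?case
      using backward a by (simp add: Q.m_assoc closed nf_lists inv_letter)
  next
    case (recursive g a)
    note D = recursive_edgeD[OF recursive(1)]
    then have a: "a \<in> carrier G" using letters_closed by blast
    \<comment> \<open>The word ends in \<open>inv a\<close>, so it is not the empty word removed from the closure.\<close>
    have "\<phi> (g, a) @ [inv a] \<in> R"
      using recursive(1) by (auto simp: stacking_relations_def intro!: relator_closure.base)
    then have "f (\<phi> (g, a)) \<otimes>\<^bsub>Q\<^esub> f [inv a] = \<one>\<^bsub>Q\<^esub>"
      using relators append[of "\<phi> (g, a)" "[inv a]"] D by (simp add: inv_letter)
    then have "f (\<phi> (g, a)) = f [a]"
      using f_inv[OF D(2)] Q.right_cancel[of "f [inv a]" "f (\<phi> (g, a))" "f [a]"] D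
      by (simp add: closed inv_letter)
    then show ?case
      using recursive(2) D a by simp
  qed
  from this[of \<one> w] show ?thesis
    using w by (simp add: nf_one f_Nil closed)
qed

theorem stacking_presentation:
  assumes "finite A"
  shows "finitely_presented_by G A R"
proof (rule finitely_presented_byI)
  show "carrier G \<subseteq> val ` lists A"
    using val_nf nf_lists by (metis image_eqI subsetI)
next
  fix N w
  assume N: "N \<lhd> F" "cls ` R \<subseteq> N" and w: "w \<in> lists A" "val w = \<one>"
  interpret N: normal N F by fact
  let ?f = "\<lambda>w. N #>\<^bsub>F\<^esub> cls w"
  have one: "?f [] = \<one>\<^bsub>F Mod N\<^esub>"
    by (metis N.coset_mult_one N.subset free_class_one one_FactGroup)
  have "?f w = ?f (nf (val w))"
  proof (rule word_map_factors[OF N.factorgroup_is_group])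
    show "?f u \<in> carrier (F Mod N)" if "u \<in> lists A" for u
      using hom_in_carrier[OF N.r_coset_hom_Mod] free_class_closed[OF that] by blast
    show "?f (u @ v) = ?f u \<otimes>\<^bsub>F Mod N\<^esub> ?f v" if "u \<in> lists A" "v \<in> lists A" for u v
      using that by (simp add: N.rcos_sum free_class_closed free_class_append)
    show "?f [a, inv a] = \<one>\<^bsub>F Mod N\<^esub>" if "a \<in> A" for a
      using one free_class_cancel[OF that] by simp
    show "?f r = \<one>\<^bsub>F Mod N\<^esub>" if "r \<in> R" for r
      using that N(2) N.rcos_const by auto
  qed (rule w)
  then have "?f w = N"
    using w one by (simp add: nf_one)
  then show "cls w \<in> N"
    using N.rcos_self[OF free_class_closed[OF w(1)] N.subgroup_axioms] by simp
qed (fact assms finite_stacking_relations[OF assms] stacking_relations_lists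
    val_stacking_relations)+

end

theorem proposition3p1:
  fixes G :: "('a, 'm) monoid_scheme"
    and A :: "'a set"
    and \<N> :: "'a list set"
    and lt :: "('a \<times> 'a) rel"
    and k :: nat
    and \<phi> :: "'a \<times> 'a \<Rightarrow> 'a list"
  assumes "group G"
    and "finite A"
    and "symmetric_generating_set G A"
    and "\<one>\<^bsub>G\<^esub> \<notin> A"
    and "stackable_structure G A \<N> lt k"
    and "stacking_map G A \<N> lt k \<phi>"
  shows "finitely_presented_by G A (stacking_relations G A \<N> \<phi>) \<and>
         (\<forall>w \<in> \<N>. \<forall>u. prefix u w \<longrightarrow> u \<in> \<N>)"
proof -
  interpret group G by fact
  interpret stacking G A \<N> lt k \<phi>
    using assms(3,5,6)
    by unfold_locales (auto simp: symmetric_generating_set_def stackable_structure_def)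
  have "u \<in> \<N>" if "w \<in> \<N>" "prefix u w" for u w
  proof (rule prefixes_of_nf)
    show "val w \<in> carrier G"
      using that(1) normal_form_set val_closed by (auto simp only: normal_form_set_def)
    show "prefix u (nf (val w))"
      using that by (simp add: nf_val)
  qed
  then show ?thesis
    using stacking_presentation[OF assms(2)] by blast
qed

end
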